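(* Let $f$ be a real polynomial and $X=\{(x,y): y\le f(x)\}$. There exists a cell decomposition of $X$ such that for any two points $A,B\in X$ and any shortest-length curve $\gamma$ from $A$ to $B$ in $X$, $\gamma$ interacts with each cell at most finitely many times, and with each $0$-cell and each $1$-cell at most twice.
   Context: A shortest-length curve from $A$ to $B$ in a set $X\subseteq\mathbb{R}^2$ is a continuous piecewise $C^2$ curve $\gamma:[a,b]\to X$ with $\gamma(a)=A$, $\gamma(b)=B$ whose length $\int_a^b|\gamma'|$ is minimal among all piecewise $C^2$ curves in $X$ from $A$ to $B$. A cell decomposition of $X\subseteq\mathbb{R}^2$ is a partition of $X$ into at most countably many pairwise disjoint subsets (cells), each homeomorphic to $\mathbb{R}^d$ for some $d\in\{0,1,2\}$ (a $d$-cell), such that the closure of each cell meets only finitely many cells. A curve $\gamma:[a,b]\to\mathbb{R}^2$ interacts with a set $e$ at most $N$ times if $\gamma^{-1}(e)$ has at most $N$ connected components. *)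

theory Defs
  imports "HOL-Analysis.Analysis" "HOL-Computational_Algebra.Polynomial"
begin

type_synonym pt = "real \<times> real"

definition is_cell :: "pt set \<Rightarrow> nat \<Rightarrow> bool" where
  "is_cell e d \<longleftrightarrow>
     (d = 0 \<and> (\<exists>p. e = {p})) \<or>
     (d = 1 \<and> e homeomorphic (UNIV :: real set)) \<or>
     (d = 2 \<and> e homeomorphic (UNIV :: (real \<times> real) set))"

definition cell_decomposition :: "pt set \<Rightarrow> pt set set \<Rightarrow> bool" where
  "cell_decomposition X C \<longleftrightarrow>
     countable C \<and> \<Union>C = X \<and>
     (\<forall>e\<in>C. \<forall>e'\<in>C. e \<noteq> e' \<longrightarrow> e \<inter> e' = {}) \<and>
     (\<forall>e\<in>C. \<exists>d\<in>{0,1,2}. is_cell e d) \<and>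
     (\<forall>e\<in>C. finite {e'\<in>C. closure e \<inter> e' \<noteq> {}})"

definition C2_on_interval :: "(real \<Rightarrow> pt) \<Rightarrow> real \<Rightarrow> real \<Rightarrow> bool" where
  "C2_on_interval g s t \<longleftrightarrow>
     (\<exists>g' g''. (\<forall>x\<in>{s..t}. (g has_vector_derivative g' x) (at x within {s..t})) \<and>
               (\<forall>x\<in>{s..t}. (g' has_vector_derivative g'' x) (at x within {s..t})) \<and>
               continuous_on {s..t} g'')"

definition piecewise_C2_curve :: "(real \<Rightarrow> pt) \<Rightarrow> real \<Rightarrow> real \<Rightarrow> bool" where
  "piecewise_C2_curve g a b \<longleftrightarrow>
     a \<le> b \<and> continuous_on {a..b} g \<and>
     (\<exists>n::nat. \<exists>t::nat \<Rightarrow> real. t 0 = a \<and> t n = b \<and>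
        (\<forall>i<n. t i < t (Suc i) \<and> C2_on_interval g (t i) (t (Suc i))))"

definition curve_length :: "(real \<Rightarrow> pt) \<Rightarrow> real \<Rightarrow> real \<Rightarrow> real" where
  "curve_length g a b = integral {a..b} (\<lambda>t. norm (vector_derivative g (at t within {a..b})))"

definition curve_in :: "pt set \<Rightarrow> pt \<Rightarrow> pt \<Rightarrow> (real \<Rightarrow> pt) \<Rightarrow> real \<Rightarrow> real \<Rightarrow> bool" where
  "curve_in X A B g a b \<longleftrightarrow>
     piecewise_C2_curve g a b \<and> g a = A \<and> g b = B \<and> g ` {a..b} \<subseteq> X"

definition shortest_curve :: "pt set \<Rightarrow> pt \<Rightarrow> pt \<Rightarrow> (real \<Rightarrow> pt) \<Rightarrow> real \<Rightarrow> real \<Rightarrow> bool" where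
  "shortest_curve X A B g a b \<longleftrightarrow>
     curve_in X A B g a b \<and>
     (\<forall>h c d. curve_in X A B h c d \<longrightarrow> curve_length g a b \<le> curve_length h c d)"

definition interaction_pieces :: "(real \<Rightarrow> pt) \<Rightarrow> real \<Rightarrow> real \<Rightarrow> pt set \<Rightarrow> real set set" where
  "interaction_pieces g a b e = components ({a..b} \<inter> g -` e)"

definition interacts_at_most :: "(real \<Rightarrow> pt) \<Rightarrow> real \<Rightarrow> real \<Rightarrow> pt set \<Rightarrow> nat \<Rightarrow> bool" where
  "interacts_at_most g a b e N \<longleftrightarrow>
     finite (interaction_pieces g a b e) \<and> card (interaction_pieces g a b e) \<le> N"

end

theory Submission
  imports Defs
begin

text \<open>
  Replacing a piece of a shortest curve by a chord lying in \<open>X\<close> cannot shorten it, so every convex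
  subset of \<open>X\<close> containing two points of the curve contains the whole piece between them. Cut the
  graph of \<open>f\<close> at the zeros of \<open>f''\<close>, and take the resulting points and open arcs together with the
  region \<open>y < f x\<close> as cells. A shortest curve visits a point only during one time interval. Between two
  points of a convex arc it must follow the arc: vertical chords keep it in the strip below the arc,
  and chords along tangent lines keep it from dropping below the graph. Between two points of a
  concave arc it is a chord, which meets the graph in no third point. Hence the boundary cells are visited
  during finitely many time intervals, and so is their complement.
\<close>

section \<open>Piecewise \<open>C\<^sup>2\<close> curves and their length\<close>

text \<open>Peeling off the leftmost piece, instead of indexing a subdivision, turns concatenation,
  restriction and the length estimates into rule inductions. \<open>piecewise_C2_curve_iff\<close>
  gives the equivalence with \<open>piecewise_C2_curve\<close>.\<close>

inductive piecewise_C2 :: "(real \<Rightarrow> pt) \<Rightarrow> real \<Rightarrow> real \<Rightarrow> bool" for g where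
  refl: "piecewise_C2 g a a"
| step: "a < c \<Longrightarrow> C2_on_interval g a c \<Longrightarrow> piecewise_C2 g c b \<Longrightarrow> piecewise_C2 g a b"

lemma piecewise_C2_le: "piecewise_C2 g a b \<Longrightarrow> a \<le> b"
  by (induction rule: piecewise_C2.induct) auto

lemma piecewise_C2_trans:
  "piecewise_C2 g a c \<Longrightarrow> piecewise_C2 g c b \<Longrightarrow> piecewise_C2 g a b"
  by (induction rule: piecewise_C2.induct) (auto intro: piecewise_C2.intros)

lemma C2_on_interval_subset:
  assumes "C2_on_interval g a b" "a \<le> c" "d \<le> b"
  shows "C2_on_interval g c d"
proof -
  obtain g' g'' where g: "\<And>x. x \<in> {a..b} \<Longrightarrow> (g has_vector_derivative g' x) (at x within {a..b})"
    "\<And>x. x \<in> {a..b} \<Longrightarrow> (g' has_vector_derivative g'' x) (at x within {a..b})"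
    "continuous_on {a..b} g''"
    using assms(1) unfolding C2_on_interval_def by blast
  have sub: "{c..d} \<subseteq> {a..b}" using assms by auto
  show ?thesis unfolding C2_on_interval_def
  proof (intro exI conjI ballI)
    fix x assume "x \<in> {c..d}"
    then have "x \<in> {a..b}" using sub by blast
    then show "(g has_vector_derivative g' x) (at x within {c..d})"
      "(g' has_vector_derivative g'' x) (at x within {c..d})"
      using has_vector_derivative_within_subset[OF g(1) sub]
        has_vector_derivative_within_subset[OF g(2) sub] by simp_all
  qed (rule continuous_on_subset[OF g(3) sub])
qed

lemma C2_on_interval_cong:
  assumes "C2_on_interval g a b" "\<And>x. x \<in> {a..b} \<Longrightarrow> g x = h x"
  shows "C2_on_interval h a b"
proof -
  obtain g' g'' where g: "\<And>x. x \<in> {a..b} \<Longrightarrow> (g has_vector_derivative g' x) (at x within {a..b})"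
    "\<And>x. x \<in> {a..b} \<Longrightarrow> (g' has_vector_derivative g'' x) (at x within {a..b})"
    "continuous_on {a..b} g''"
    using assms(1) unfolding C2_on_interval_def by blast
  have "(h has_vector_derivative g' x) (at x within {a..b})" if "x \<in> {a..b}" for x
    by (rule has_vector_derivative_transform[OF that _ g(1)[OF that]]) (simp add: assms(2))
  then show ?thesis unfolding C2_on_interval_def using g(2,3) by blast
qed

lemma piecewise_C2_cong:
  "piecewise_C2 g a b \<Longrightarrow> (\<And>x. x \<in> {a..b} \<Longrightarrow> g x = h x) \<Longrightarrow> piecewise_C2 h a b"
proof (induction rule: piecewise_C2.induct)
  case (step a c b)
  have "c \<le> b" using step.hyps by (simp add: piecewise_C2_le)
  then show ?case
    using step by (intro piecewise_C2.step[of a c]) (auto intro: C2_on_interval_cong)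
qed (rule piecewise_C2.refl)

lemma piecewise_C2_split:
  "piecewise_C2 g a b \<Longrightarrow> a \<le> c \<Longrightarrow> c \<le> b \<Longrightarrow> piecewise_C2 g a c \<and> piecewise_C2 g c b"
proof (induction rule: piecewise_C2.induct)
  case (refl a)
  then show ?case by (simp add: piecewise_C2.refl)
next
  case (step a d b)
  consider "c = a" | "a < c" "c < d" | "d \<le> c" using step.prems by linarith
  then show ?case
  proof cases
    case 1
    then show ?thesis using step.hyps by (auto intro: piecewise_C2.intros)
  next
    case 2
    then have "C2_on_interval g a c" "C2_on_interval g c d"
      using step.hyps by (auto intro: C2_on_interval_subset)
    then show ?thesis using step.hyps 2 by (auto intro: piecewise_C2.intros)
  next
    case 3
    then show ?thesis using step by (auto intro: piecewise_C2.intros)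
  qed
qed

lemma C2_on_interval_continuous: "C2_on_interval g a b \<Longrightarrow> continuous_on {a..b} g"
  unfolding C2_on_interval_def continuous_on_eq_continuous_within
  using has_vector_derivative_continuous by blast

lemma piecewise_C2_continuous: "piecewise_C2 g a b \<Longrightarrow> continuous_on {a..b} g"
proof (induction rule: piecewise_C2.induct)
  case (step a c b)
  have "{a..b} = {a..c} \<union> {c..b}" using step.hyps piecewise_C2_le by fastforce
  then show ?case using step by (simp add: continuous_on_closed_Un C2_on_interval_continuous)
qed simp

lemma piecewise_C2_curve_iff: "piecewise_C2_curve g a b \<longleftrightarrow> piecewise_C2 g a b"
proof
  have "piecewise_C2 g (t 0) (t n)"
    if "\<forall>i<n. t i < t (Suc i) \<and> C2_on_interval g (t i) (t (Suc i))" for n and t :: "nat \<Rightarrow> real"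
    using that
  proof (induction n arbitrary: t)
    case (Suc n)
    have "piecewise_C2 g (t (Suc 0)) (t (Suc n))"
      using Suc.IH[of "\<lambda>i. t (Suc i)"] Suc.prems by auto
    then show ?case using Suc.prems by (auto intro: piecewise_C2.step)
  qed (simp add: piecewise_C2.refl)
  then show "piecewise_C2_curve g a b \<Longrightarrow> piecewise_C2 g a b"
    unfolding piecewise_C2_curve_def by blast
next
  assume pw: "piecewise_C2 g a b"
  then have "\<exists>n. \<exists>t::nat \<Rightarrow> real. t 0 = a \<and> t n = b \<and>
        (\<forall>i<n. t i < t (Suc i) \<and> C2_on_interval g (t i) (t (Suc i)))"
  proof (induction rule: piecewise_C2.induct)
    case (refl a)
    show ?case by (rule exI[of _ 0], rule exI[of _ "\<lambda>_. a"]) simp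
  next
    case (step a c b)
    then obtain n t where t: "t 0 = c" "t n = b"
      "\<forall>i<n. t i < t (Suc i) \<and> C2_on_interval g (t i) (t (Suc i))" by blast
    show ?case
      by (rule exI[of _ "Suc n"], rule exI[of _ "case_nat a t"])
        (use t step.hyps in \<open>auto split: nat.split\<close>)
  qed
  then show "piecewise_C2_curve g a b"
    using pw unfolding piecewise_C2_curve_def
    by (simp add: piecewise_C2_le piecewise_C2_continuous)
qed

text \<open>The two integrands can differ only at the two ends, a null set. The new integrand does
  not depend on the interval, so lengths of adjacent pieces simply add.\<close>

lemma curve_length_eq:
  "curve_length g a b = integral {a..b} (\<lambda>t. norm (vector_derivative g (at t)))"
  unfolding curve_length_def
proof (rule integral_spike[of "{a,b}"])
  fix x assume "x \<in> {a..b} - {a,b}"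
  then have "at x within {a..b} = at x" by (intro at_within_Icc_at) auto
  then show "norm (vector_derivative g (at x)) = norm (vector_derivative g (at x within {a..b}))"
    by simp
qed simp

text \<open>Here the derivative relative to the interval is the right form: agreement on
  \<open>{a..b}\<close> does not control two-sided derivatives at the ends.\<close>

lemma curve_length_cong:
  assumes "\<And>x. x \<in> {a..b} \<Longrightarrow> g x = h x"
  shows "curve_length g a b = curve_length h a b"
proof -
  have "vector_derivative g (at x within {a..b}) = vector_derivative h (at x within {a..b})"
    if x: "x \<in> {a..b}" for x
  proof -
    have "(g has_vector_derivative v) (at x within {a..b}) \<longleftrightarrow>
          (h has_vector_derivative v) (at x within {a..b})" for v
      using has_vector_derivative_transform[OF x, of g h v] has_vector_derivative_transform[OF x, of h g v]
        assms by auto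
    then show ?thesis by (simp add: vector_derivative_def)
  qed
  then show ?thesis unfolding curve_length_def by (intro integral_cong) simp
qed

text \<open>The derivative \<open>g'\<close> is itself differentiable, hence continuous, so the
  speed is integrable. The chord bound is the fundamental theorem of calculus followed by moving the
  norm inside the integral.\<close>

lemma C2_on_interval_speed:
  assumes "C2_on_interval g a b" "a \<le> b"
  shows "(\<lambda>t. norm (vector_derivative g (at t))) integrable_on {a..b}"
    and "dist (g a) (g b) \<le> curve_length g a b"
proof -
  obtain g' g'' where g: "\<And>x. x \<in> {a..b} \<Longrightarrow> (g has_vector_derivative g' x) (at x within {a..b})"
    "\<And>x. x \<in> {a..b} \<Longrightarrow> (g' has_vector_derivative g'' x) (at x within {a..b})"
    using assms(1) unfolding C2_on_interval_def by blast
  have cont: "continuous_on {a..b} (\<lambda>x. norm (g' x))"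
    unfolding continuous_on_eq_continuous_within
    using g(2) by (blast intro: continuous_norm has_vector_derivative_continuous)
  have eq: "norm (vector_derivative g (at x)) = norm (g' x)" if x: "x \<in> {a..b} - {a,b}" for x
  proof -
    have "at x within {a..b} = at x" using x by (intro at_within_Icc_at) auto
    then have "(g has_vector_derivative g' x) (at x)" using g(1)[of x] x by simp
    then show ?thesis by (simp add: vector_derivative_at)
  qed
  have int: "(\<lambda>x. norm (g' x)) integrable_on {a..b}"
    by (rule integrable_continuous_real[OF cont])
  show "(\<lambda>t. norm (vector_derivative g (at t))) integrable_on {a..b}"
    by (rule integrable_spike[OF int, of "{a,b}"]) (use eq in auto)
  have len: "curve_length g a b = integral {a..b} (\<lambda>x. norm (g' x))"
    unfolding curve_length_eq by (rule integral_spike[of "{a,b}"]) (use eq in auto)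
  have ftc: "(g' has_integral (g b - g a)) {a..b}"
    using fundamental_theorem_of_calculus[OF assms(2), of g g'] g(1) by auto
  have "norm (integral {a..b} g') \<le> integral {a..b} (\<lambda>x. norm (g' x))"
    by (rule integral_norm_bound_integral) (use ftc int in auto)
  then show "dist (g a) (g b) \<le> curve_length g a b"
    using ftc by (simp add: len integral_unique dist_norm norm_minus_commute)
qed

lemma piecewise_C2_speed_integrable:
  "piecewise_C2 g a b \<Longrightarrow> (\<lambda>t. norm (vector_derivative g (at t))) integrable_on {a..b}"
proof (induction rule: piecewise_C2.induct)
  case (step a c b)
  then show ?case
    using C2_on_interval_speed(1)[of g a c] piecewise_C2_le[of g c b]
    by (intro Henstock_Kurzweil_Integration.integrable_combine[of a c b]) auto
next
  case (refl a)
  show ?case using integrable_on_refl[of _ a] by simp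
qed

lemma curve_length_combine:
  assumes "piecewise_C2 g a b" "a \<le> c" "c \<le> b"
  shows "curve_length g a b = curve_length g a c + curve_length g c b"
  unfolding curve_length_eq
  using Henstock_Kurzweil_Integration.integral_combine[OF assms(2,3)
      piecewise_C2_speed_integrable[OF assms(1)]] by simp

lemma dist_le_curve_length: "piecewise_C2 g a b \<Longrightarrow> dist (g a) (g b) \<le> curve_length g a b"
proof (induction rule: piecewise_C2.induct)
  case (refl a)
  then show ?case by (simp add: curve_length_def)
next
  case (step a c b)
  have "curve_length g a b = curve_length g a c + curve_length g c b"
    by (rule curve_length_combine) (use step.hyps piecewise_C2_le in \<open>auto intro: piecewise_C2.step\<close>)
  then show ?case
    using C2_on_interval_speed(2)[of g a c] step dist_triangle[of "g a" "g b" "g c"] by simp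
qed

text \<open>The segment is run at constant speed over the given parameter interval, so that it can
  replace a piece of a curve without reparametrizing the rest.\<close>

lemma piecewise_C2_linepath:
  fixes P Q :: pt
  assumes "s < t"
  defines "h \<equiv> \<lambda>x. P + ((x - s) / (t - s)) *\<^sub>R (Q - P)"
  shows "piecewise_C2 h s t" and "curve_length h s t = dist P Q"
proof -
  define v where "v = (1 / (t - s)) *\<^sub>R (Q - P)"
  have d: "(h has_vector_derivative v) (at x within S)" for x S
    unfolding h_def v_def using assms(1) by (auto intro!: derivative_eq_intros)
  have "C2_on_interval h s t" unfolding C2_on_interval_def
    by (rule exI[of _ "\<lambda>_. v"], rule exI[of _ "\<lambda>_. 0"]) (auto intro: d)
  then show "piecewise_C2 h s t"
    using assms(1) by (auto intro: piecewise_C2.intros)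
  have "vector_derivative h (at x) = v" for x
    using d by (rule vector_derivative_at)
  then show "curve_length h s t = dist P Q"
    unfolding curve_length_eq v_def using assms(1) by (simp add: dist_norm norm_minus_commute)
qed

section \<open>Shortest curves\<close>

text \<open>The curve with the piece over \<open>{s..t}\<close> replaced by its chord is a
  competitor. Minimality bounds the length of that piece by the chord, which forces equality in the
  triangle inequality through \<open>g u\<close>.\<close>

lemma shortest_curve_in_segment:
  assumes sc: "shortest_curve X A B g a b" and ord: "a \<le> s" "s \<le> u" "u \<le> t" "t \<le> b"
    and seg: "closed_segment (g s) (g t) \<subseteq> X"
  shows "g u \<in> closed_segment (g s) (g t)"
proof (cases "s = t")
  case True
  then show ?thesis using ord by simp
next
  case False
  then have st: "s < t" using ord by simp
  have pw: "piecewise_C2 g a b" and ends: "g a = A" "g b = B" and im: "g ` {a..b} \<subseteq> X"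
    using sc unfolding shortest_curve_def curve_in_def piecewise_C2_curve_iff by auto
  define l where "l = (\<lambda>x. g s + ((x - s) / (t - s)) *\<^sub>R (g t - g s))"
  \<comment> \<open>Since \<open>l\<close> and \<open>g\<close> agree at \<open>s\<close> and
    \<open>t\<close>, \<open>h\<close> can be viewed as either of them there, and the three closed
    pieces fit together.\<close>
  define h where "h = (\<lambda>x. if s \<le> x \<and> x \<le> t then l x else g x)"
  have l_ends: "l s = g s" "l t = g t" using st by (auto simp: l_def)
  have h1: "h x = g x" if "x \<in> {a..s}" for x
    using that l_ends by (auto simp: h_def)
  have h2: "h x = l x" if "x \<in> {s..t}" for x
    using that by (auto simp: h_def)
  have h3: "h x = g x" if "x \<in> {t..b}" for x
    using that l_ends by (auto simp: h_def)
  have pws: "piecewise_C2 g a s" "piecewise_C2 g s b" "piecewise_C2 g s u" "piecewise_C2 g u b"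
    "piecewise_C2 g u t" "piecewise_C2 g t b"
    using piecewise_C2_split[OF pw, of s] piecewise_C2_split[of g s b u]
      piecewise_C2_split[of g u b t] ord by auto
  have pwh: "piecewise_C2 h a s" "piecewise_C2 h s t" "piecewise_C2 h t b"
    using piecewise_C2_cong[OF pws(1), of h] piecewise_C2_cong[OF pws(6), of h]
      piecewise_C2_cong[OF piecewise_C2_linepath(1)[OF st, of "g s" "g t"], of h] h1 h2 h3
    by (auto simp: l_def)
  have pwh': "piecewise_C2 h s b" "piecewise_C2 h a b"
    using pwh by (blast intro: piecewise_C2_trans)+
  have "l x \<in> closed_segment (g s) (g t)" if "x \<in> {s..t}" for x
    unfolding in_segment using that st
    by (intro exI[of _ "(x - s) / (t - s)"]) (simp add: l_def scaleR_left_diff_distrib scaleR_right_diff_distrib)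
  then have "h ` {a..b} \<subseteq> X"
    using seg im by (auto simp: h_def)
  then have "curve_in X A B h a b"
    using pwh' ends h1 h3 ord unfolding curve_in_def piecewise_C2_curve_iff by auto
  then have "curve_length g a b \<le> curve_length h a b"
    using sc unfolding shortest_curve_def by blast
  also have "\<dots> = curve_length h a s + (curve_length h s t + curve_length h t b)"
    using curve_length_combine[OF pwh'(2), of s] curve_length_combine[OF pwh'(1), of t] ord by simp
  also have "\<dots> = curve_length g a s + (dist (g s) (g t) + curve_length g t b)"
    using curve_length_cong[of a s h g] curve_length_cong[of t b h g] curve_length_cong[of s t h l]
      h1 h2 h3 piecewise_C2_linepath(2)[OF st, of "g s" "g t"] by (simp add: l_def)
  \<comment> \<open>The lengths over \<open>{a..s}\<close> and \<open>{t..b}\<close> are common to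
    both curves and cancel.\<close>
  finally have "curve_length g s u + curve_length g u t \<le> dist (g s) (g t)"
    using curve_length_combine[OF pw, of s] curve_length_combine[OF pws(2), of u]
      curve_length_combine[OF pws(4), of t] ord by simp
  moreover have "dist (g s) (g u) \<le> curve_length g s u" "dist (g u) (g t) \<le> curve_length g u t"
    using pws by (auto intro: dist_le_curve_length)
  moreover have "dist (g s) (g t) \<le> dist (g s) (g u) + dist (g u) (g t)"
    by (rule dist_triangle)
  ultimately have "between (g s, g t) (g u)"
    unfolding between by linarith
  then show ?thesis by (simp add: between_mem_segment)
qed

lemma shortest_curve_in_convex:
  assumes "shortest_curve X A B g a b" "a \<le> s" "s \<le> u" "u \<le> t" "t \<le> b"
    and "convex K" "K \<subseteq> X" "g s \<in> K" "g t \<in> K"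
  shows "g u \<in> K"
proof -
  have "closed_segment (g s) (g t) \<subseteq> K" using assms by (intro closed_segment_subset)
  then show ?thesis using shortest_curve_in_segment[OF assms(1-5)] assms(7) by blast
qed

text \<open>A singleton is convex, so a shortest curve cannot leave a point and return to
  it.\<close>

lemma shortest_curve_vimage_point:
  assumes "shortest_curve X A B g a b" "p \<in> X"
  shows "is_interval ({a..b} \<inter> g -` {p})"
  unfolding is_interval_1 using shortest_curve_in_convex[OF assms(1), of _ _ _ "{p}"] assms(2) by auto

text \<open>Supplies the ends of the chords used for cutting: \<open>\<phi>\<close> will be the
  abscissa or a linear functional that is constant along a tangent line.\<close>

lemma shortest_curve_IVT:
  assumes "shortest_curve X A B g a b" "a \<le> s" "s \<le> t" "t \<le> b"
    and "continuous_on UNIV \<phi>" "(c::real) \<in> closed_segment (\<phi> (g s)) (\<phi> (g t))"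
  obtains x where "s \<le> x" "x \<le> t" "\<phi> (g x) = c"
proof -
  have "continuous_on {a..b} g"
    using assms(1) unfolding shortest_curve_def curve_in_def piecewise_C2_curve_def by blast
  then have cont: "continuous_on {s..t} (\<lambda>x. \<phi> (g x))"
    using assms(2-5) continuous_on_compose2[of UNIV \<phi> "{s..t}" g] continuous_on_subset[of "{a..b}" g]
    by auto
  have "connected ((\<lambda>x. \<phi> (g x)) ` {s..t})"
    using cont by (intro connected_continuous_image) auto
  then have "closed_segment (\<phi> (g s)) (\<phi> (g t)) \<subseteq> (\<lambda>x. \<phi> (g x)) ` {s..t}"
    using assms(3) by (intro closed_segment_subset) (auto simp: connected_convex_1)
  then show ?thesis using assms(6) that by force
qed

section \<open>Shortest curves below a graph\<close>

lemma shortest_curve_le: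
  assumes "shortest_curve {(x, y). y \<le> f x} A B g a b" "a \<le> u" "u \<le> b"
  shows "snd (g u) \<le> f (fst (g u))"
proof -
  have "g u \<in> {(x, y). y \<le> f x}"
    using assms unfolding shortest_curve_def curve_in_def image_subset_iff by simp
  then show ?thesis by auto
qed

text \<open>An excursion out of the strip would cross the same bounding vertical line before and
  after \<open>u\<close>. The part of that line below the graph is convex, so the curve would stay
  on it in between.\<close>

lemma shortest_curve_in_strip:
  assumes sc: "shortest_curve {(x, y). y \<le> poly f x} A B g a b"
    and ord: "a \<le> s" "s \<le> u" "u \<le> t" "t \<le> b"
    and p: "p \<le> fst (g s)" "fst (g s) \<le> q" "p \<le> fst (g t)" "fst (g t) \<le> q"
  shows "p \<le> fst (g u) \<and> fst (g u) \<le> q"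
proof -
  have crossing: "fst (g u) = c"
    if c: "c \<in> closed_segment (fst (g s)) (fst (g u))" "c \<in> closed_segment (fst (g u)) (fst (g t))" for c
  proof -
    obtain s' where s': "s \<le> s'" "s' \<le> u" "fst (g s') = c"
      using shortest_curve_IVT[OF sc, of s u fst] c ord continuous_on_fst[OF continuous_on_id] by auto
    obtain t' where t': "u \<le> t'" "t' \<le> t" "fst (g t') = c"
      using shortest_curve_IVT[OF sc, of u t fst] c ord continuous_on_fst[OF continuous_on_id] by auto
    \<comment> \<open>The vertical ray at abscissa \<open>c\<close>, written as a hyperplane cut by
      a half-plane to make its convexity immediate.\<close>
    define K :: "pt set" where "K = {z. (1, 0) \<bullet> z = c} \<inter> {z. (0, 1) \<bullet> z \<le> poly f c}"
    have "convex K" unfolding K_def by (intro convex_Int convex_hyperplane convex_halfspace_le)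
    moreover have "K \<subseteq> {(x, y). y \<le> poly f x}" by (auto simp: K_def)
    moreover have "g s' \<in> K" "g t' \<in> K"
      using s' t' ord shortest_curve_le[OF sc, of s'] shortest_curve_le[OF sc, of t']
      by (simp_all add: K_def inner_prod_def)
    ultimately have "g u \<in> K"
      using shortest_curve_in_convex[OF sc, of s' u t' K] s' t' ord by auto
    then show ?thesis by (simp add: K_def inner_prod_def)
  qed
  have "False" if "fst (g u) < p"
    using crossing[of p] p that by (simp add: closed_segment_eq_real_ivl split: if_splits)
  moreover have "False" if "q < fst (g u)"
    using crossing[of q] p that by (simp add: closed_segment_eq_real_ivl split: if_splits)
  ultimately show ?thesis by force
qed

section \<open>Convex arcs of the graph\<close>

lemma poly_above_tangent:
  fixes f :: "real poly"
  assumes "convex I" "open I" "\<And>x. x \<in> I \<Longrightarrow> 0 \<le> poly (pderiv (pderiv f)) x" "r \<in> I" "x \<in> I"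
  shows "poly f r + poly (pderiv f) r * (x - r) \<le> poly f x"
proof -
  have "convex_on I (poly f)"
    by (rule f''_ge0_imp_convex[OF assms(1) poly_DERIV poly_DERIV assms(3)])
  then show ?thesis
    using convex_on_imp_above_tangent[of I "poly f" r x "poly (pderiv f) r"] assms
    by (simp add: convex_connected interior_open has_field_derivative_at_within)
qed

text \<open>A point of the curve strictly below the graph could be cut off along the tangent line above it.\<close>

lemma shortest_curve_vimage_convex_arc:
  assumes sc: "shortest_curve {(x, y). y \<le> poly f x} A B g a b"
    and I: "convex I" "open I" "\<And>x. x \<in> I \<Longrightarrow> 0 \<le> poly (pderiv (pderiv f)) x"
  shows "is_interval ({a..b} \<inter> g -` ((\<lambda>x. (x, poly f x)) ` I))"
  unfolding is_interval_1
proof safe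
  fix s t u p q
  assume st: "s \<in> {a..b}" "t \<in> {a..b}" and u: "s \<le> u" "u \<le> t"
    and p: "g s = (p, poly f p)" "p \<in> I" and q: "g t = (q, poly f q)" "q \<in> I"
  show "u \<in> {a..b}" using st u by simp
  define r where "r = fst (g u)"
  define J where "J = closed_segment p q"
  have strip: "fst (g x) \<in> J" if "s \<le> x" "x \<le> t" for x
    using shortest_curve_in_strip[OF sc, of s x t "min p q" "max p q"] that st p q
    by (auto simp: J_def closed_segment_eq_real_ivl min_def max_def split: if_splits)
  have "J \<subseteq> I" unfolding J_def using p(2) q(2) I(1) by (rule closed_segment_subset)
  have r: "r \<in> J" "r \<in> I" using strip[of u] u \<open>J \<subseteq> I\<close> by (auto simp: r_def)
  define m where "m = poly (pderiv f) r"
  \<comment> \<open>\<open>\<phi>\<close> sends \<open>(x, y)\<close> to \<open>y - m * x\<close>.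
    Its level line at \<open>poly f r - m * r\<close> is the tangent to the graph at abscissa
    \<open>r\<close>.\<close>
  define \<phi> where "\<phi> = (\<lambda>z. (- m, 1) \<bullet> (z :: pt))"
  have cont: "continuous_on UNIV \<phi>" unfolding \<phi>_def by (intro continuous_intros)
  have tangent: "poly f r - m * r \<le> poly f x - m * x" if "x \<in> I" for x
    using poly_above_tangent[OF I r(2) that] by (simp add: m_def algebra_simps)
  have below: "snd (g u) \<le> poly f r"
    using shortest_curve_le[OF sc, of u] st u by (simp add: r_def)
  have \<phi>u: "\<phi> (g u) \<le> poly f r - m * r"
    using below by (simp add: \<phi>_def inner_prod_def r_def)
  have \<phi>s: "poly f r - m * r \<le> \<phi> (g s)" and \<phi>t: "poly f r - m * r \<le> \<phi> (g t)"
    using tangent[OF p(2)] tangent[OF q(2)] by (auto simp: \<phi>_def p q)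
  \<comment> \<open>The ends of the piece lie on or above the tangent and \<open>g u\<close> on or
    below it, so the curve meets the tangent both before and after \<open>u\<close>.\<close>
  have seg: "poly f r - m * r \<in> closed_segment (\<phi> (g s)) (\<phi> (g u))"
    "poly f r - m * r \<in> closed_segment (\<phi> (g u)) (\<phi> (g t))"
    using \<phi>u \<phi>s \<phi>t by (auto simp: closed_segment_eq_real_ivl)
  have bounds: "a \<le> s" "u \<le> b" "a \<le> u" "t \<le> b" using st u by auto
  obtain s' where s': "s \<le> s'" "s' \<le> u" "\<phi> (g s') = poly f r - m * r"
    by (rule shortest_curve_IVT[OF sc bounds(1) u(1) bounds(2) cont seg(1)])
  obtain t' where t': "u \<le> t'" "t' \<le> t" "\<phi> (g t') = poly f r - m * r"
    by (rule shortest_curve_IVT[OF sc bounds(3) u(2) bounds(4) cont seg(2)])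
  \<comment> \<open>The part of the tangent over \<open>J\<close>, which lies in the region because
    the arc is convex over \<open>I\<close>. The strip bound is what places \<open>g s'\<close> and
    \<open>g t'\<close> over \<open>J\<close>.\<close>
  define K :: "pt set" where "K = {z. (- m, 1) \<bullet> z = poly f r - m * r} \<inter> (J \<times> UNIV)"
  have "convex K" unfolding K_def J_def
    by (intro convex_Int convex_hyperplane convex_Times convex_closed_segment convex_UNIV)
  moreover have "K \<subseteq> {(x, y). y \<le> poly f x}"
    using tangent \<open>J \<subseteq> I\<close> by (fastforce simp: K_def)
  moreover have "g s' \<in> K" "g t' \<in> K"
    using s' t' u strip[of s'] strip[of t'] by (auto simp: K_def \<phi>_def mem_Times_iff)
  ultimately have "g u \<in> K"
    using shortest_curve_in_convex[OF sc, of s' u t' K] s' t' st by auto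
  \<comment> \<open>The tangent touches the graph at \<open>r\<close>, the abscissa of
    \<open>g u\<close> itself.\<close>
  then have "snd (g u) = poly f r" by (simp add: K_def inner_prod_def r_def)
  then have "g u = (r, poly f r)" by (simp add: r_def prod_eq_iff)
  then show "u \<in> g -` ((\<lambda>x. (x, poly f x)) ` I)" using r by auto
qed

section \<open>Concave arcs of the graph\<close>

text \<open>The hypothesis says that the two chord slopes agree. The mean value theorem turns them
  into equal values of the first derivative at two points, and a further application to that
  derivative gives the root.\<close>

lemma poly_collinear_imp_pderiv2_root:
  fixes f :: "real poly"
  assumes "x < y" "y < z" "(poly f y - poly f x) * (z - y) = (poly f z - poly f y) * (y - x)"
  obtains w where "x < w" "w < z" "poly (pderiv (pderiv f)) w = 0"
proof -
  obtain v where v: "x < v" "v < y" "poly f y - poly f x = (y - x) * poly (pderiv f) v"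
    using poly_MVT[OF assms(1)] by blast
  obtain v' where v': "y < v'" "v' < z" "poly f z - poly f y = (z - y) * poly (pderiv f) v'"
    using poly_MVT[OF assms(2)] by blast
  have "poly (pderiv f) v = poly (pderiv f) v'"
    using assms v(3) v'(3) by simp
  moreover obtain w where "v < w" "w < v'"
    "poly (pderiv f) v' - poly (pderiv f) v = (v' - v) * poly (pderiv (pderiv f)) w"
    using poly_MVT[of v v' "pderiv f"] v v' by auto
  ultimately show ?thesis using v v' by (intro that[of w]) auto
qed

text \<open>By concavity the chord lies in the region, so the curve follows it. A third point of the
  arc on the chord would give a root of the second derivative inside \<open>I\<close>; strict
  negativity is what excludes it.\<close>

lemma shortest_curve_concave_arc:
  assumes sc: "shortest_curve {(x, y). y \<le> poly f x} A B g a b"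
    and I: "convex I" "\<And>x. x \<in> I \<Longrightarrow> poly (pderiv (pderiv f)) x < 0"
    and ord: "a \<le> s" "s \<le> u" "u \<le> t" "t \<le> b"
    and g: "g s = (x, poly f x)" "g u = (y, poly f y)" "g t = (z, poly f z)"
    and mem: "x \<in> I" "z \<in> I"
  shows "g u = g s \<or> g u = g t"
proof -
  have "concave_on I (poly f)"
    by (rule f''_le0_imp_concave[OF I(1) poly_DERIV poly_DERIV]) (use I(2) in \<open>auto intro: less_imp_le\<close>)
  then have conc: "(1 - c) * poly f v + c * poly f w \<le> poly f ((1 - c) * v + c * w)"
    if "0 \<le> c" "c \<le> 1" "v \<in> I" "w \<in> I" for c v w
    using that concave_onD[of I "poly f" c v w] by simp
  have "closed_segment (g s) (g t) \<subseteq> {(x, y). y \<le> poly f x}"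
    using conc mem by (auto simp: closed_segment_def g)
  then have "g u \<in> closed_segment (g s) (g t)"
    using shortest_curve_in_segment[OF sc ord] by simp
  then obtain c where c: "0 \<le> c" "c \<le> 1" "y = (1 - c) * x + c * z"
    "poly f y = (1 - c) * poly f x + c * poly f z"
    by (auto simp: closed_segment_def g)
  have y: "y - x = c * (z - x)" "z - y = (1 - c) * (z - x)"
    and fy: "poly f y - poly f x = c * (poly f z - poly f x)"
    "poly f z - poly f y = (1 - c) * (poly f z - poly f x)"
    using c by (auto simp: algebra_simps)
  have collinear: "(poly f y - poly f x) * (z - y) = (poly f z - poly f y) * (y - x)"
    unfolding y fy by (simp add: algebra_simps)
  have "is_interval I" using I(1) by (simp add: is_interval_convex_1)
  then have no_root: "poly (pderiv (pderiv f)) w \<noteq> 0" if "min x z < w" "w < max x z" for w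
    using that mem I(2)[of w] unfolding is_interval_1
    by (metis less_irrefl less_imp_le max_def min_def)
  have "y = x \<or> y = z"
  proof (rule ccontr)
    assume "\<not> ?thesis"
    then have "c \<noteq> 0" "c \<noteq> 1" "x \<noteq> z" using c(3) by (auto simp: algebra_simps)
    then have "0 < c" "c < 1" using c by auto
    \<comment> \<open>The order of the parameters does not determine the order of the
      abscissas.\<close>
    consider "x < z" | "z < x" using \<open>x \<noteq> z\<close> by linarith
    then show False
    proof cases
      case 1
      then have "0 < y - x" "0 < z - y"
        unfolding y using \<open>0 < c\<close> \<open>c < 1\<close> by simp_all
      then obtain w where "x < w" "w < z" "poly (pderiv (pderiv f)) w = 0"
        using collinear poly_collinear_imp_pderiv2_root[of x y z f] by auto
      then show False using no_root[of w] 1 by auto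
    next
      case 2
      then have "y - x < 0" "z - y < 0"
        unfolding y using \<open>0 < c\<close> \<open>c < 1\<close> by (simp_all add: mult_pos_neg)
      moreover have "(poly f y - poly f z) * (x - y) = (poly f x - poly f y) * (y - z)"
        using collinear by (simp add: algebra_simps)
      ultimately obtain w where "z < w" "w < x" "poly (pderiv (pderiv f)) w = 0"
        using poly_collinear_imp_pderiv2_root[of z y x f] by auto
      then show False using no_root[of w] 2 by auto
    qed
  qed
  then show ?thesis using g by auto
qed

text \<open>The curve meets the arc in at most two points, and each of them accounts for a single
  parameter interval.\<close>

lemma shortest_curve_vimage_concave_arc:
  assumes sc: "shortest_curve {(x, y). y \<le> poly f x} A B g a b"
    and I: "convex I" "\<And>x. x \<in> I \<Longrightarrow> poly (pderiv (pderiv f)) x < 0"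
  obtains F where "finite F" "card F \<le> 2" "\<forall>T\<in>F. is_interval T"
    "{a..b} \<inter> g -` ((\<lambda>x. (x, poly f x)) ` I) = \<Union>F"
proof -
  define S where "S = {a..b} \<inter> g -` ((\<lambda>x. (x, poly f x)) ` I)"
  have med: "g u = g s \<or> g u = g t" if "s \<le> u" "u \<le> t" "s \<in> S" "u \<in> S" "t \<in> S" for s u t
    using that shortest_curve_concave_arc[OF sc I, of s u t] by (auto simp: S_def)
  \<comment> \<open>Whichever parameter is in the middle, its point coincides with one of the other
    two.\<close>
  have no_three: "g u = g s \<or> g u = g t \<or> g s = g t" if "s \<in> S" "u \<in> S" "t \<in> S" for s u t
    using that med[of s u t] med[of t u s] med[of u s t] med[of t s u] med[of s t u] med[of u t s]
    by (metis linear)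
  have "\<exists>P Q. g ` S \<subseteq> {P, Q}"
  proof (cases "\<exists>s\<in>S. \<exists>t\<in>S. g s \<noteq> g t")
    case True
    then show ?thesis using no_three by (metis image_subsetI insertCI)
  next
    case False
    then show ?thesis by (metis image_subsetI insertCI)
  qed
  then obtain P Q where PQ: "g ` S \<subseteq> {P, Q}" by blast
  then have fin: "finite (g ` S)" by (rule finite_subset) simp
  have "card (g ` S) \<le> card {P, Q}" using PQ by (intro card_mono) simp_all
  also have "\<dots> \<le> 2" by (simp add: card_insert_if)
  finally have card: "card (g ` S) \<le> 2" .
  define F where "F = (\<lambda>p. {a..b} \<inter> g -` {p}) ` g ` S"
  show ?thesis
  proof (rule that[of F])
    show "finite F" using fin by (simp add: F_def)
    show "card F \<le> 2" unfolding F_def using card card_image_le[OF fin] order_trans by blast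
    show "\<forall>T\<in>F. is_interval T"
    proof
      fix T assume "T \<in> F"
      then obtain p where "p \<in> g ` S" and T: "T = {a..b} \<inter> g -` {p}" by (auto simp: F_def)
      then have "p \<in> {(x, y). y \<le> poly f x}" by (auto simp: S_def)
      then show "is_interval T" unfolding T by (rule shortest_curve_vimage_point[OF sc])
    qed
    show "{a..b} \<inter> g -` ((\<lambda>x. (x, poly f x)) ` I) = \<Union>F"
      unfolding F_def S_def by auto
  qed
qed

section \<open>Finite unions of intervals\<close>

text \<open>Each member of \<open>F\<close> is connected, so sending it to the component of one of
  its points reaches every component. The value at an empty member is arbitrary but harmless, as
  only an upper bound is needed.\<close>

lemma card_components_Union_intervals_le:
  fixes F :: "real set set"
  assumes "finite F" "\<And>T. T \<in> F \<Longrightarrow> is_interval T"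
  shows "finite (components (\<Union>F))" "card (components (\<Union>F)) \<le> card F"
proof -
  have "components (\<Union>F) \<subseteq> (\<lambda>T. connected_component_set (\<Union>F) (SOME x. x \<in> T)) ` F"
  proof
    fix c assume "c \<in> components (\<Union>F)"
    then obtain x T where x: "c = connected_component_set (\<Union>F) x" "x \<in> T" "T \<in> F"
      by (auto simp: components_def)
    define y where "y = (SOME x. x \<in> T)"
    have "y \<in> T" unfolding y_def using x(2) by (rule someI)
    moreover have "connected T" using assms(2)[OF x(3)] by (simp add: is_interval_connected_1)
    ultimately have "connected_component (\<Union>F) x y"
      using x unfolding connected_component_def by blast
    then have "c = connected_component_set (\<Union>F) y"
      using x(1) connected_component_eq by blast
    then show "c \<in> (\<lambda>T. connected_component_set (\<Union>F) (SOME x. x \<in> T)) ` F"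
      using x(3) by (auto simp: y_def)
  qed
  then show "finite (components (\<Union>F))" "card (components (\<Union>F)) \<le> card F"
    using assms(1) by (auto intro: finite_subset surj_card_le)
qed

text \<open>The complement of an interval is the union of the points to its left and those to its
  right. Removing one more interval thus replaces each piece by at most two.\<close>

lemma interval_diff_Union:
  fixes F :: "real set set"
  assumes "finite F" "\<And>T. T \<in> F \<Longrightarrow> is_interval T" "is_interval J"
  shows "\<exists>G. finite G \<and> (\<forall>T\<in>G. is_interval T) \<and> J - \<Union>F = \<Union>G"
  using assms(1,2)
proof (induction F rule: finite_induct)
  case empty
  show ?case by (rule exI[of _ "{J}"]) (simp add: assms(3))
next
  case (insert I F)
  then obtain G where G: "finite G" "\<forall>T\<in>G. is_interval T" "J - \<Union>F = \<Union>G" by auto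
  define L R where "L = {x. \<forall>i\<in>I. x < i}" and "R = {x. \<forall>i\<in>I. i < x}"
  have "is_interval I" using insert.prems by simp
  have LR: "- I = L \<union> R"
  proof (intro equalityI subsetI)
    fix x assume "x \<in> - I"
    then have x: "x \<notin> I" by simp
    have "\<not> (i \<le> x \<and> x \<le> j)" if "i \<in> I" "j \<in> I" for i j
      using \<open>is_interval I\<close> x that unfolding is_interval_1 by blast
    then show "x \<in> L \<union> R" using x unfolding L_def R_def by (force simp: not_le)
  qed (auto simp: L_def R_def)
  have "is_interval L" "is_interval R"
    unfolding L_def R_def is_interval_1 by (auto intro: le_less_trans less_le_trans)
  then have "\<forall>T\<in>(\<lambda>T. T \<inter> L) ` G \<union> (\<lambda>T. T \<inter> R) ` G. is_interval T"
    using G(2) by (auto intro: is_interval_Int)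
  moreover have "J - \<Union>(insert I F) = \<Union>G \<inter> - I" using G(3) by blast
  then have "J - \<Union>(insert I F) = \<Union>((\<lambda>T. T \<inter> L) ` G \<union> (\<lambda>T. T \<inter> R) ` G)"
    unfolding LR by auto
  ultimately show ?case using G(1)
    by (intro exI[of _ "(\<lambda>T. T \<inter> L) ` G \<union> (\<lambda>T. T \<inter> R) ` G"]) simp
qed

section \<open>The cells\<close>

text \<open>\<open>I\<close> may be unbounded. Its image under \<open>arctan\<close> is bounded,
  hence an open interval with finite ends, and all such intervals are homeomorphic to the
  line.\<close>

lemma homeomorphic_open_convex_real:
  fixes I :: "real set"
  assumes "open I" "convex I" "I \<noteq> {}"
  shows "I homeomorphic (UNIV :: real set)"
proof -
  define J where "J = arctan ` I"
  have inj: "inj_on arctan I" by (simp add: inj_on_def arctan_eq_iff)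
  have cont: "continuous_on I arctan" by (intro continuous_intros)
  have "I homeomorphic J"
    unfolding J_def homeomorphic_def
    using injective_into_1d_eq_homeomorphism[OF cont convex_imp_path_connected[OF assms(2)]] inj
    by blast
  have "open J" unfolding J_def
    using injective_into_1d_imp_open_map_UNIV[OF assms(1) cont inj subset_refl] .
  have "connected J" unfolding J_def
    using cont assms(2) by (intro connected_continuous_image convex_connected)
  have "bounded J"
    by (rule bounded_subset[of "{- (pi / 2)..pi / 2}"])
      (use arctan_bounded in \<open>auto simp: J_def less_imp_le\<close>)
  have "J \<noteq> {}" using assms(3) by (simp add: J_def)
  have "J = {Inf J<..<Sup J}"
  proof
    show "J \<subseteq> {Inf J<..<Sup J}"
    proof
      fix x assume "x \<in> J"
      then obtain e where e: "e > 0" "cball x e \<subseteq> J"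
        using \<open>open J\<close> open_contains_cball by blast
      then have "x - e \<in> J" "x + e \<in> J" by (auto simp: dist_norm)
      then have "Inf J \<le> x - e" "x + e \<le> Sup J"
        using \<open>bounded J\<close> by (auto intro!: cInf_lower cSup_upper bounded_imp_bdd_above bounded_imp_bdd_below)
      then show "x \<in> {Inf J<..<Sup J}" using e by auto
    qed
    show "{Inf J<..<Sup J} \<subseteq> J"
    proof
      fix x assume x: "x \<in> {Inf J<..<Sup J}"
      obtain y where "y \<in> J" "y < x" using x cInf_lessD[OF \<open>J \<noteq> {}\<close>, of x] by auto
      moreover obtain z where "z \<in> J" "x < z" using x less_cSupD[OF \<open>J \<noteq> {}\<close>, of x] by auto
      ultimately show "x \<in> J"
        using \<open>connected J\<close> unfolding is_interval_connected_1[symmetric] is_interval_1 by (meson less_imp_le)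
    qed
  qed
  moreover have "Inf J < Sup J"
    using calculation \<open>J \<noteq> {}\<close> by (metis greaterThanLessThan_empty_iff not_le)
  ultimately have "J homeomorphic (UNIV :: real set)"
    using homeomorphic_open_interval_UNIV by metis
  then show ?thesis using \<open>I homeomorphic J\<close> homeomorphic_trans by blast
qed

lemma homeomorphic_graph_real:
  fixes f :: "real \<Rightarrow> real"
  assumes "continuous_on I f"
  shows "(\<lambda>x. (x, f x)) ` I homeomorphic I"
  unfolding homeomorphic_def homeomorphism_def
  by (rule exI[of _ fst], rule exI[of _ "\<lambda>x. (x, f x)"])
    (auto simp: image_image intro!: continuous_intros assms)

text \<open>The logarithm of the vertical distance to the graph stretches each open vertical ray to
  a full line.\<close>

lemma homeomorphic_strict_hypograph:
  fixes f :: "real \<Rightarrow> real"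
  assumes "continuous_on UNIV f"
  shows "{(x, y). y < f x} homeomorphic (UNIV :: (real \<times> real) set)"
  unfolding homeomorphic_def homeomorphism_def
proof (intro exI conjI ballI)
  let ?h = "\<lambda>z :: real \<times> real. (fst z, ln (f (fst z) - snd z))"
  let ?k = "\<lambda>z :: real \<times> real. (fst z, f (fst z) - exp (snd z))"
  have cf: "continuous_on S (\<lambda>z :: real \<times> real. f (fst z))" for S
    by (rule continuous_on_compose2[OF assms]) (auto intro!: continuous_intros)
  show "continuous_on {(x, y). y < f x} ?h"
    by (intro continuous_intros cf) auto
  show "continuous_on UNIV ?k"
    by (intro continuous_intros cf)
  show kh: "?k (?h z) = z" if "z \<in> {(x, y). y < f x}" for z using that by auto
  show hk: "?h (?k z) = z" if "z \<in> UNIV" for z by simp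
  have k_in: "?k z \<in> {(x, y). y < f x}" for z by simp
  show "?h ` {(x, y). y < f x} = UNIV"
  proof (intro equalityI subsetI UNIV_I)
    fix z
    show "z \<in> ?h ` {(x, y). y < f x}"
      using hk[of z] by (intro image_eqI[of _ ?h "?k z"] k_in) simp
  qed
  show "?k ` UNIV = {(x, y). y < f x}"
  proof (intro equalityI subsetI)
    fix z assume "z \<in> {(x, y). y < f x}"
    then show "z \<in> range ?k" using kh[of z] by (intro image_eqI[of _ ?k "?h z"]) simp_all
  qed (use k_in in blast)
qed

text \<open>By invariance of dimension, the bound two required of cells of dimension 0 and 1 does
  not have to be shown for the open region.\<close>

lemma homeomorphic_plane_not_lower_cell:
  fixes U :: "pt set"
  assumes "U homeomorphic (UNIV :: (real \<times> real) set)"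
  shows "\<not> is_cell U 0" "\<not> is_cell U 1"
proof -
  have "infinite (UNIV :: (real \<times> real) set)"
    by (simp add: finite_prod infinite_UNIV_char_0)
  then have "infinite U"
    using assms unfolding homeomorphic_def homeomorphism_def by (metis finite_imageI)
  then show "\<not> is_cell U 0" by (auto simp: is_cell_def)
  have "\<not> U homeomorphic (UNIV :: real set)"
  proof
    assume "U homeomorphic (UNIV :: real set)"
    then have "(UNIV :: (real \<times> real) set) homeomorphic (UNIV :: real set)"
      using assms homeomorphic_sym homeomorphic_trans by blast
    then show False by (simp add: homeomorphic_UNIV_UNIV)
  qed
  then show "\<not> is_cell U 1" by (simp add: is_cell_def)
qed

text \<open>For \<open>S \<subseteq> Z\<close>: the points off \<open>Z\<close> that have exactly the elements of \<open>S\<close> on their left.\<close>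

definition gap :: "real set \<Rightarrow> real set \<Rightarrow> real set" where
  "gap Z S = {x. (\<forall>z\<in>S. z < x) \<and> (\<forall>z\<in>Z - S. x < z)}"

lemma gap_eq: "gap Z S = (\<Inter>z\<in>S. {z<..}) \<inter> (\<Inter>z\<in>Z - S. {..<z})"
  by (auto simp: gap_def)

lemma open_gap: "finite Z \<Longrightarrow> S \<subseteq> Z \<Longrightarrow> open (gap Z S)"
  unfolding gap_eq by (intro open_Int open_INT) (auto intro: finite_subset)

lemma convex_gap: "convex (gap Z S)"
  unfolding gap_eq by (intro convex_Int convex_INT) auto

lemma gap_disjoint: "S \<subseteq> Z \<Longrightarrow> x \<in> gap Z S \<Longrightarrow> x \<notin> Z"
  unfolding gap_def by blast

text \<open>Any point of a gap recovers its index set, so gaps with different indices are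
  disjoint.\<close>

lemma gap_unique: "S \<subseteq> Z \<Longrightarrow> x \<in> gap Z S \<Longrightarrow> S = {z \<in> Z. z < x}"
  unfolding gap_def by (auto dest: less_asym)

lemma gap_cover: "x \<notin> Z \<Longrightarrow> x \<in> gap Z {z \<in> Z. z < x}"
  unfolding gap_def by (auto simp: not_less order.strict_iff_order)

lemma poly_sign_cases:
  fixes p :: "real poly"
  assumes "convex I" "\<And>x. x \<in> I \<Longrightarrow> poly p x \<noteq> 0"
  shows "(\<forall>x\<in>I. 0 < poly p x) \<or> (\<forall>x\<in>I. poly p x < 0)"
proof (rule ccontr)
  assume "\<not> ?thesis"
  then obtain x y where xy: "x \<in> I" "y \<in> I" "poly p x < 0" "0 < poly p y"
    using assms(2) by (metis linorder_neqE_linordered_idom)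
  have "connected (poly p ` I)"
    using assms(1) by (intro connected_continuous_image convex_connected continuous_intros)
  then have "closed_segment (poly p x) (poly p y) \<subseteq> poly p ` I"
    using xy by (intro closed_segment_subset) (auto simp: connected_convex_1)
  moreover have "0 \<in> closed_segment (poly p x) (poly p y)"
    using xy by (simp add: closed_segment_eq_real_ivl)
  ultimately show False using assms(2) by force
qed

section \<open>The decomposition and its interaction bounds\<close>

theorem theorem2p10:
  fixes f :: "real poly"
  defines "X \<equiv> {(x, y). y \<le> poly f x}"
  shows "\<exists>C. cell_decomposition X C \<and>
    (\<forall>A\<in>X. \<forall>B\<in>X. \<forall>g a b. shortest_curve X A B g a b \<longrightarrow>
       (\<forall>e\<in>C. finite (interaction_pieces g a b e)) \<and>
       (\<forall>e\<in>C. (is_cell e 0 \<or> is_cell e 1) \<longrightarrow> interacts_at_most g a b e 2))"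
proof -
  \<comment> \<open>If the second derivative vanishes identically, every point is a root. Then
    nothing is cut, and the whole line is the only gap.\<close>
  define Z where "Z = (if pderiv (pderiv f) = 0 then {} else {x. poly (pderiv (pderiv f)) x = 0})"
  have finZ: "finite Z" by (simp add: Z_def poly_roots_finite)
  define G where "G = (\<lambda>x. (x, poly f x))"
  define U where "U = {(x, y). y < poly f x}"
  \<comment> \<open>All subsets of \<open>Z\<close> serve as indices, so most gaps may be empty;
    these are discarded because the empty set is not a cell.\<close>
  define D where "D = (\<lambda>z. G ` {z}) ` Z \<union> (\<lambda>S. G ` gap Z S) ` {S \<in> Pow Z. gap Z S \<noteq> {}}"
  have D_cases: "(\<exists>z\<in>Z. e = G ` {z}) \<or> (\<exists>S. S \<subseteq> Z \<and> gap Z S \<noteq> {} \<and> e = G ` gap Z S)"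
    if "e \<in> D" for e
    using that by (auto simp: D_def)
  have finD: "finite D" using finZ by (simp add: D_def)
  have UnD: "\<Union>D = range G"
  proof
    show "\<Union>D \<subseteq> range G" by (auto simp: D_def)
    have "\<exists>e\<in>D. G x \<in> e" for x
    proof (cases "x \<in> Z")
      case True
      then show ?thesis by (auto simp: D_def)
    next
      case False
      then have x: "x \<in> gap Z {z \<in> Z. z < x}" by (rule gap_cover)
      then have "{z \<in> Z. z < x} \<in> {S \<in> Pow Z. gap Z S \<noteq> {}}" by auto
      then have "G ` gap Z {z \<in> Z. z < x} \<in> D" unfolding D_def by (intro UnI2 imageI)
      then show ?thesis using x by (intro bexI[of _ "G ` gap Z {z \<in> Z. z < x}"] imageI)
    qed
    then show "range G \<subseteq> \<Union>D" by blast
  qed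
  have X_eq: "X = U \<union> range G" by (auto simp: X_def U_def G_def)
  have disjU: "U \<inter> range G = {}" by (auto simp: U_def G_def)
  have same_cell: "e = e'" if ee': "e \<in> D" "e' \<in> D" "p \<in> e" "p \<in> e'" for e e' p
  proof -
    obtain x where p: "p = G x" using ee' UnD by blast
    have inv: "x \<in> T" if "p \<in> G ` T" for T using that by (auto simp: p G_def)
    have e_eq: "e = (if x \<in> Z then G ` {x} else G ` gap Z {z \<in> Z. z < x})"
      if e: "e \<in> D" "p \<in> e" for e
      using D_cases[OF e(1)]
    proof (elim disjE exE bexE conjE)
      fix z assume "z \<in> Z" "e = G ` {z}"
      then show ?thesis using inv[of "{z}"] e(2) by auto
    next
      fix S assume S: "S \<subseteq> Z" "e = G ` gap Z S"
      then have "x \<in> gap Z S" using inv e(2) by simp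
      then show ?thesis using gap_disjoint[OF S(1)] gap_unique[OF S(1)] S(2) by auto
    qed
    show ?thesis using e_eq[of e] e_eq[of e'] ee' by simp
  qed
  have cellU: "U homeomorphic (UNIV :: (real \<times> real) set)"
    unfolding U_def by (intro homeomorphic_strict_hypograph continuous_intros)
  have cellD: "is_cell e 0 \<or> is_cell e 1" if "e \<in> D" for e
    using D_cases[OF that]
  proof (elim disjE exE bexE conjE)
    fix S assume S: "S \<subseteq> Z" "gap Z S \<noteq> {}" "e = G ` gap Z S"
    have "e homeomorphic gap Z S"
      unfolding S(3) G_def by (intro homeomorphic_graph_real continuous_intros)
    also have "gap Z S homeomorphic (UNIV :: real set)"
      using S finZ by (intro homeomorphic_open_convex_real open_gap convex_gap)
    finally show ?thesis by (simp add: is_cell_def)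
  qed (simp add: is_cell_def)
  have "cell_decomposition X (insert U D)"
    unfolding cell_decomposition_def
  proof (intro conjI ballI impI)
    show "countable (insert U D)" using finD by (simp add: countable_finite)
    show "\<Union>(insert U D) = X" using UnD X_eq by simp
    \<comment> \<open>There are finitely many cells altogether, so closures need no
      analysis.\<close>
    show "finite {e' \<in> insert U D. closure e \<inter> e' \<noteq> {}}" for e using finD by simp
    show "\<exists>d\<in>{0, 1, 2}. is_cell e d" if "e \<in> insert U D" for e
      using that cellU cellD by (auto simp: is_cell_def)
    show "e \<inter> e' = {}" if "e \<in> insert U D" "e' \<in> insert U D" "e \<noteq> e'" for e e'
    proof (rule ccontr)
      assume "e \<inter> e' \<noteq> {}"
      then obtain p where p: "p \<in> e" "p \<in> e'" by blast
      have "p \<in> range G" if "p \<in> d" "d \<in> D" for d using that UnD by (metis UnionI)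
      then show False using that p same_cell disjU by (metis IntI empty_iff insertE)
    qed
  qed
  moreover have "(\<forall>e\<in>insert U D. finite (interaction_pieces g a b e)) \<and>
      (\<forall>e\<in>insert U D. (is_cell e 0 \<or> is_cell e 1) \<longrightarrow> interacts_at_most g a b e 2)"
    if "shortest_curve X A B g a b" for A B g a b
  proof -
    have sc: "shortest_curve {(x, y). y \<le> poly f x} A B g a b" using that by (simp add: X_def)
    have "\<exists>F. finite F \<and> card F \<le> 2 \<and> (\<forall>T\<in>F. is_interval T) \<and> {a..b} \<inter> g -` e = \<Union>F"
      if "e \<in> D" for e
      using D_cases[OF that]
    proof (elim disjE exE bexE conjE)
      fix z assume e: "e = G ` {z}"
      have "is_interval ({a..b} \<inter> g -` e)"
        using shortest_curve_vimage_point[OF sc, of "G z"] by (simp add: e G_def)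
      then show ?thesis by (intro exI[of _ "{{a..b} \<inter> g -` e}"]) simp
    next
      fix S assume S: "S \<subseteq> Z" "e = G ` gap Z S"
      have conv: "convex (gap Z S)" by (rule convex_gap)
      \<comment> \<open>The second derivative has no root in a gap and keeps its sign there; the
        identically zero case counts as convex.\<close>
      consider "\<forall>x\<in>gap Z S. 0 \<le> poly (pderiv (pderiv f)) x"
        | "\<forall>x\<in>gap Z S. poly (pderiv (pderiv f)) x < 0"
      proof (cases "pderiv (pderiv f) = 0")
        case False
        then have "poly (pderiv (pderiv f)) x \<noteq> 0" if "x \<in> gap Z S" for x
          using gap_disjoint[OF S(1) that] by (simp add: Z_def)
        then show ?thesis using poly_sign_cases[OF conv] that less_imp_le by metis
      qed (simp add: that)
      then show ?thesis
      proof cases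
        case 1
        then have "is_interval ({a..b} \<inter> g -` e)"
          unfolding S(2) G_def
          using shortest_curve_vimage_convex_arc[OF sc conv open_gap[OF finZ S(1)]] by simp
        then show ?thesis by (intro exI[of _ "{{a..b} \<inter> g -` e}"]) simp
      next
        case 2
        then obtain F where "finite F" "card F \<le> 2" "\<forall>T\<in>F. is_interval T"
          "{a..b} \<inter> g -` e = \<Union>F"
          unfolding S(2) G_def using shortest_curve_vimage_concave_arc[OF sc conv] by metis
        then show ?thesis by blast
      qed
    qed
    then obtain F where F: "\<And>e. e \<in> D \<Longrightarrow> finite (F e) \<and> card (F e) \<le> 2 \<and>
      (\<forall>T\<in>F e. is_interval T) \<and> {a..b} \<inter> g -` e = \<Union>(F e)"
      by metis
    have D2: "interacts_at_most g a b e 2" if "e \<in> D" for e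
      using F[OF that] card_components_Union_intervals_le[of "F e"]
      unfolding interacts_at_most_def interaction_pieces_def by auto
    have "finite (\<Union>e\<in>D. F e)" using finD F by blast
    moreover have "is_interval T" if "T \<in> (\<Union>e\<in>D. F e)" for T using that F by blast
    \<comment> \<open>The parameters not spent on the graph. Since the curve stays in
      \<open>X\<close>, they form exactly its preimage of \<open>U\<close>.\<close>
    ultimately obtain H where H: "finite H" "\<forall>T\<in>H. is_interval T"
      "{a..b} - \<Union>(\<Union>e\<in>D. F e) = \<Union>H"
      using interval_diff_Union[of "\<Union>e\<in>D. F e" "{a..b}"] is_interval_cc by metis
    have "\<Union>(\<Union>e\<in>D. F e) = (\<Union>e\<in>D. \<Union>(F e))" by blast
    also have "\<dots> = (\<Union>e\<in>D. {a..b} \<inter> g -` e)" using F by simp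
    also have "\<dots> = {a..b} \<inter> g -` range G" unfolding UnD[symmetric] by blast
    finally have "\<Union>H = {a..b} - {a..b} \<inter> g -` range G" using H(3) by simp
    then have "\<Union>H = {a..b} - g -` range G" by (simp only: Diff_Int Diff_cancel Un_empty_left)
    moreover have "g ` {a..b} \<subseteq> X"
      using that unfolding shortest_curve_def curve_in_def by blast
    then have "g u \<in> U \<longleftrightarrow> g u \<notin> range G" if "u \<in> {a..b}" for u
      using that disjU unfolding X_eq image_subset_iff by (metis IntI UnE empty_iff)
    then have "{a..b} \<inter> g -` U = {a..b} - g -` range G"
      by (intro set_eqI) (simp only: Int_iff Diff_iff vimage_eq cong: conj_cong)
    ultimately have "finite (interaction_pieces g a b U)"
      using card_components_Union_intervals_le(1)[of H] H unfolding interaction_pieces_def by metis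
    then show ?thesis
      using D2 homeomorphic_plane_not_lower_cell[OF cellU] by (auto simp: interacts_at_most_def)
  qed
  ultimately show ?thesis by blast
qed

end
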